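(* Let $\lambda\in\mathbb{D}$ and $z_0\in\mathbb{D}\setminus\{0\}$. Then the boundary $\partial V_{\mathcal{P}}(z_0,\lambda)$ is the Jordan curve given by $$(-\pi,\pi]\ni\theta\mapsto \int_0^{z_0}H_{e^{i\theta},\lambda}(\zeta)\,d\zeta=\int_0^{z_0}\frac{1+[2(1-\beta)(\cos\gamma)e^{-i\gamma}-1]\,\delta(e^{i\theta}\zeta,\lambda)\zeta}{1-\delta(e^{i\theta}\zeta,\lambda)\zeta}\,d\zeta .$$ Moreover, if $\int_0^{z_0}P(\zeta)\,d\zeta=\int_0^{z_0}H_{e^{i\theta},\lambda}(\zeta)\,d\zeta$ for some $P\in\mathcal{P}(\lambda)$ and some $\theta\in(-\pi,\pi]$, then $P(z)=H_{e^{i\theta},\lambda}(z)$ for all $z\in\mathbb{D}$.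
   Context: $\mathbb{D}=\{z\in\mathbb{C}:|z|<1\}$. Fix real numbers $\beta<1$ and $\gamma$ with $|\gamma|<\pi/2$. $\mathcal{P}_{\gamma,\beta}$ is the class of analytic functions $P$ on $\mathbb{D}$ with $P(0)=1$ and $\mathrm{Re}\,(e^{i\gamma}P(z))>\beta\cos\gamma$ for all $z\in\mathbb{D}$. For $\lambda\in\overline{\mathbb{D}}$ and $z_0\in\mathbb{D}$ set $$\mathcal{P}(\lambda)=\{P\in\mathcal{P}_{\gamma,\beta}:\ P'(0)=2(1-\beta)e^{-i\gamma}\lambda\cos\gamma\},\qquad V_{\mathcal{P}}(z_0,\lambda)=\left\{\int_0^{z_0}P(\zeta)\,d\zeta:\ P\in\mathcal{P}(\lambda)\right\}.$$ For $|\lambda|<1$ and $a\in\overline{\mathbb{D}}$ set $$\delta(z,\lambda)=\frac{z+\lambda}{1+\overline{\lambda}z},\qquad H_{a,\lambda}(z)=1+2(1-\beta)e^{-i\gamma}\cos\gamma\,\frac{\delta(az,\lambda)z}{1-\delta(az,\lambda)z},\quad z\in\mathbb{D}.$$ A Jordan curve is a simple closed curve. *)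

theory Defs
  imports "HOL-Complex_Analysis.Complex_Analysis"
begin

text \<open>
  Functions on the unit disc are total functions on the complex numbers that are constrained
  only on \<^term>\<open>ball 0 1 :: complex set\<close>; values elsewhere are irrelevant to everything below.
\<close>

definition class_P :: "real \<Rightarrow> real \<Rightarrow> (complex \<Rightarrow> complex) set" where
  "class_P \<gamma> \<beta> = {P. P holomorphic_on ball 0 1 \<and> P 0 = 1 \<and>
     (\<forall>z\<in>ball 0 1. Re (cis \<gamma> * P z) > \<beta> * cos \<gamma>)}"

definition class_P_at :: "real \<Rightarrow> real \<Rightarrow> complex \<Rightarrow> (complex \<Rightarrow> complex) set" where
  "class_P_at \<gamma> \<beta> lam = {P \<in> class_P \<gamma> \<beta>.
     deriv P 0 = 2 * (1 - of_real \<beta>) * cis (- \<gamma>) * lam * of_real (cos \<gamma>)}"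

text \<open>
  Integrands are holomorphic on the (convex) disc, so the integral from 0 to \<open>z0\<close> does not
  depend on the path in the disc; it is taken along the segment.
\<close>

definition V_P :: "real \<Rightarrow> real \<Rightarrow> complex \<Rightarrow> complex \<Rightarrow> complex set" where
  "V_P \<gamma> \<beta> z0 lam = {contour_integral (linepath 0 z0) P | P. P \<in> class_P_at \<gamma> \<beta> lam}"

definition delta :: "complex \<Rightarrow> complex \<Rightarrow> complex" where
  "delta z lam = (z + lam) / (1 + cnj lam * z)"

definition H_fun :: "real \<Rightarrow> real \<Rightarrow> complex \<Rightarrow> complex \<Rightarrow> complex \<Rightarrow> complex" where
  "H_fun \<gamma> \<beta> a lam z = 1 + 2 * (1 - of_real \<beta>) * cis (- \<gamma>) * of_real (cos \<gamma>) *
     (delta (a * z) lam * z / (1 - delta (a * z) lam * z))"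

definition boundary_curve :: "real \<Rightarrow> real \<Rightarrow> complex \<Rightarrow> complex \<Rightarrow> real \<Rightarrow> complex" where
  "boundary_curve \<gamma> \<beta> lam z0 \<theta> = contour_integral (linepath 0 z0) (H_fun \<gamma> \<beta> (cis \<theta>) lam)"

text \<open>
  A curve parametrized by an angle in \<open>(-\<pi>, \<pi>]\<close> and given by a formula for all real angles is a
  Jordan curve if its rescaling to \<open>[0, 1]\<close>, with the initial point at \<open>-\<pi>\<close> adjoined, is a
  simple closed path.
\<close>

definition jordan_curve_angle :: "(real \<Rightarrow> complex) \<Rightarrow> bool" where
  "jordan_curve_angle \<phi> \<longleftrightarrow>
     (let g = (\<lambda>t. \<phi> ((2 * t - 1) * pi)) in simple_path g \<and> pathfinish g = pathstart g)"

end

theory Submission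
  imports Defs
begin

text \<open>
  Write \<open>c = 2 (1 - \<beta>) e\<^bsup>-i\<gamma>\<^esup> cos \<gamma>\<close> and \<open>H\<^sub>a\<close> for \<open>H_fun \<gamma> \<beta> a lam\<close>. Two applications of the
  Schwarz lemma show that every function of the class has the form
  \<open>P(z) = H\<^bsub>k(z)\<^esub>(z)\<close> with \<open>k\<close> holomorphic and \<open>|k| \<le> 1\<close> (lemma \<open>class_P_at_cases\<close>). At a fixed point
  \<open>z \<noteq> 0\<close> the values \<open>P(z)\<close> therefore lie in a closed disc, whose boundary consists of the \<open>H\<^sub>\<eta>(z)\<close> with
  \<open>|\<eta>| = 1\<close>. The outward normal of this disc at \<open>H\<^sub>\<eta>(z)\<close> is \<open>G'(z)\<close>, up to a positive factor, where
  \<open>G'(z) = c (1 - |\<lambda>|\<^sup>2) \<eta> z\<^sup>2 / (1 + (cnj \<lambda> \<eta> - \<lambda>) z - \<eta> z\<^sup>2)\<^sup>2\<close> and \<open>G(0) = 0\<close>; that is,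
  \<open>H\<^sub>\<eta> - P = G' R\<close> with \<open>Re R \<ge> 0\<close>, and \<open>Re R\<close> vanishes only where \<open>k = \<eta>\<close>
  (lemmas \<open>H_fun_diff\<close> and \<open>Re_H_den_quotient\<close>).

  The pointwise information passes to integrals by a comparison principle: if \<open>Re (N'/G') \<ge> 0\<close>,
  if \<open>N\<close> vanishes at \<open>0\<close> at least to the order of \<open>G\<close>, and if \<open>Re (1 + z G''/G') > 0\<close>, then
  \<open>Re (N/G) \<ge> 0\<close>, and equality at one point forces \<open>Re (N'/G') = 0\<close> everywhere
  (lemma \<open>Re_quotient_of_primitives\<close>). Here it is applied to \<open>N(z) = \<integral> (H\<^sub>\<eta> - P)\<close> over \<open>[0, z]\<close>; the
  denominator of \<open>G'\<close> has the required convexity property (lemma \<open>Re_inverse_H_den\<close>). So the whole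
  region of variability lies in a half-plane that has \<open>\<integral> H\<^sub>\<eta>\<close> on its edge, and only \<open>P = H\<^sub>\<eta>\<close>
  attains that value. This makes every point of the curve a boundary point and gives the uniqueness
  statement; uniqueness in turn makes the curve simple.

  Finally, the class is defined by affine conditions, so the region is convex. A convex set
  whose frontier contains a Jordan curve has exactly this curve as its frontier
  (lemma \<open>frontier_convex_eq_Jordan_curve\<close>).
\<close>

section \<open>Jordan curves in the frontier of a convex set\<close>

text \<open>
  A convex closed set contains the inside of every Jordan curve that it contains, so the inside of
  the curve lies in the interior of \<open>V\<close>. Conversely this interior is connected and misses the
  curve, so it cannot also reach the outside. Hence it equals the inside of the curve, whose
  frontier is the curve.
\<close>
lemma frontier_convex_eq_Jordan_curve:
  fixes g :: "real \<Rightarrow> complex"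
  assumes "convex V" "simple_path g" "pathfinish g = pathstart g" "path_image g \<subseteq> frontier V"
  shows "frontier V = path_image g"
proof -
  let ?J = "path_image g"
  note J = Jordan_inside_outside[OF assms(2,3)]
  have "- closure V \<subseteq> outside ?J"
    using assms by (intro outside_subset_convex convex_closure) (auto simp: frontier_def)
  then have "inside ?J \<subseteq> closure V"
    using J by blast
  then have sub: "inside ?J \<subseteq> interior V"
    using J convex_interior_closure[OF assms(1)] interior_maximal by metis
  have disj: "interior V \<inter> ?J = {}"
    using assms(4) by (auto simp: frontier_def)
  have "interior V \<subseteq> inside ?J"
  proof (rule ccontr)
    assume "\<not> interior V \<subseteq> inside ?J"
    then have "interior V \<inter> outside ?J \<noteq> {}"
      using J disj by blast
    moreover have "interior V \<inter> inside ?J \<noteq> {}"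
      using sub J by blast
    moreover have "connected (interior V)"
      using assms(1) convex_connected convex_interior by blast
    moreover have "interior V \<subseteq> inside ?J \<union> outside ?J"
      using J disj by blast
    ultimately show False
      using J connectedD[of "interior V" "inside ?J" "outside ?J"] by (metis Int_commute inf_bot_right)
  qed
  with sub have eq: "interior V = inside ?J"
    by blast
  then have ne: "interior V \<noteq> {}"
    using J by blast
  have "frontier V = frontier (interior V)"
    unfolding frontier_def using convex_closure_interior[OF assms(1) ne] by simp
  also have "\<dots> = ?J"
    using J eq by simp
  finally show ?thesis .
qed

section \<open>Comparison of primitives with a convex majorant\<close>

text \<open>
  A minimum principle in the style of Jack's lemma. Take for \<open>z1\<close> a minimum point of \<open>Re q\<close> on the
  closed disc of radius \<open>|z0|\<close>. Rotations keep that disc invariant, so the angular derivative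
  vanishes and \<open>z1 q'(z1)\<close> is real; contractions map the disc into itself, so the radial derivative
  is not positive. This works for interior minima and for \<open>z1 = 0\<close> as well.
\<close>
lemma minimum_Re_disc:
  assumes q: "q holomorphic_on ball 0 1" and z0: "z0 \<in> ball 0 1"
  obtains z1 :: complex and k :: real where "z1 \<in> ball 0 1" "Re (q z1) \<le> Re (q z0)" "k \<ge> 0" "z1 * deriv q z1 = - of_real k"
proof -
  define r where "r = norm z0"
  have sub: "cball 0 r \<subseteq> ball (0::complex) 1"
    using z0 by (auto simp: r_def)
  have "continuous_on (cball 0 r) (\<lambda>z. Re (q z))"
    using holomorphic_on_imp_continuous_on[OF q] sub by (auto intro!: continuous_intros intro: continuous_on_subset)
  then obtain z1 where z1: "z1 \<in> cball 0 r" and min: "\<And>z. z \<in> cball 0 r \<Longrightarrow> Re (q z1) \<le> Re (q z)"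
    using continuous_attains_inf[of "cball 0 r" "\<lambda>z. Re (q z)"] by (auto simp: r_def)
  have z1': "z1 \<in> ball 0 1"
    using z1 sub by blast
  \<comment> \<open>The direction \<open>v = \<i>\<close> gives the rotations, \<open>v = 1\<close> the dilations.\<close>
  have der: "((\<lambda>t. Re (q (z1 * exp (of_real t * v)))) has_real_derivative Re (z1 * deriv q z1 * v)) (at 0)" for v
  proof -
    have "(q has_field_derivative deriv q z1) (at (z1 * exp (of_real 0 * v)))"
      using holomorphic_derivI[OF q open_ball z1'] by simp
    moreover have "((\<lambda>s. z1 * exp (s * v)) has_field_derivative z1 * v) (at (of_real 0))"
      by (auto intro!: derivative_eq_intros)
    ultimately have "((\<lambda>s. q (z1 * exp (s * v))) has_field_derivative deriv q z1 * (z1 * v)) (at (of_real 0))"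
      using DERIV_chain2[of q "deriv q z1" "\<lambda>s. z1 * exp (s * v)" "of_real 0"] by simp
    from has_field_derivative_Re[OF has_vector_derivative_real_field[OF this, of UNIV]]
    show ?thesis
      by (simp add: mult_ac)
  qed
  have "Re (z1 * deriv q z1 * \<i>) = 0"
  proof (rule DERIV_local_min[OF der zero_less_one])
    show "\<forall>y. \<bar>0 - y\<bar> < 1 \<longrightarrow> Re (q (z1 * exp (of_real 0 * \<i>))) \<le> Re (q (z1 * exp (of_real y * \<i>)))"
      using z1 by (auto intro!: min simp: norm_mult)
  qed
  moreover have "\<not> Re (z1 * deriv q z1 * 1) > 0"
  proof
    assume "Re (z1 * deriv q z1 * 1) > 0"
    from DERIV_pos_inc_left[OF der this] obtain d where "d > 0" and
      d: "\<And>h. h > 0 \<Longrightarrow> h < d \<Longrightarrow> Re (q (z1 * exp (of_real (0 - h) * 1))) < Re (q (z1 * exp (of_real 0 * 1)))"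
      by blast
    have "norm (z1 * exp (of_real (0 - d/2) * 1)) \<le> norm z1 * 1"
      unfolding norm_mult using \<open>d > 0\<close> by (intro mult_left_mono) auto
    then have "Re (q z1) \<le> Re (q (z1 * exp (of_real (0 - d/2) * 1)))"
      using z1 by (intro min) auto
    with d[of "d/2"] \<open>d > 0\<close> show False
      by simp
  qed
  ultimately have "z1 * deriv q z1 = - of_real (- Re (z1 * deriv q z1))"
    by (simp add: complex_eq_iff)
  moreover have "- Re (z1 * deriv q z1) \<ge> 0"
    using \<open>\<not> Re (z1 * deriv q z1 * 1) > 0\<close> by simp
  moreover have "Re (q z1) \<le> Re (q z0)"
    by (rule min) (simp add: r_def)
  ultimately show ?thesis
    using that z1' by blast
qed

lemma ident_mult_cancel:
  assumes A: "A holomorphic_on ball 0 1" and B: "B holomorphic_on ball 0 1"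
    and eq: "\<And>z. z \<in> ball 0 1 \<Longrightarrow> z * A z = z * B (z::complex)" and z: "z \<in> ball 0 1"
  shows "A z = B z"
proof (cases "z = 0")
  case True
  have d: "((\<lambda>z. z * C z) has_field_derivative C 0) (at 0)" if "C holomorphic_on ball 0 1" for C :: "complex \<Rightarrow> complex"
    using holomorphic_derivI[OF that open_ball, of 0] by (auto intro!: derivative_eq_intros)
  have "((\<lambda>z. z * B z) has_field_derivative A 0) (at 0)"
    by (rule has_field_derivative_transform_within_open[OF d[OF A], of "ball 0 1"]) (use eq in auto)
  then show ?thesis
    using DERIV_unique d[OF B] True by blast
next
  case False
  then show ?thesis
    using eq[OF z] by simp
qed

text \<open>
  Removes the zero at the origin from both \<open>f\<close> and \<open>f'\<close>: the quotients by \<open>z\<close> extend holomorphically,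
  and the derivative becomes the operator \<open>h \<mapsto> (k + 1) h + z h'\<close>. Quotients of two such
  primitives can then be formed on the whole disc.
\<close>
lemma primitive_factor:
  assumes "F holomorphic_on ball 0 1" and "f 0 = 0"
    and "\<And>z. z \<in> ball 0 1 \<Longrightarrow> (f has_field_derivative z ^ k * F z) (at z)"
  shows "\<exists>h. h holomorphic_on ball 0 1 \<and> (\<forall>z\<in>ball 0 1. f z = z ^ Suc k * h z \<and>
           of_nat (Suc k) * h z + z * deriv h z = F z)"
  using assms
proof (induction k arbitrary: F)
  case 0
  have "f holomorphic_on ball 0 1"
    using 0(3) holomorphic_on_open open_ball by blast
  from Schwarz3[OF this 0(2)] obtain h where h: "h holomorphic_on ball 0 1"
    and fh: "\<And>z. norm z < 1 \<Longrightarrow> f z = z * h z"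
    by metis
  have "h z + z * deriv h z = F z" if z: "z \<in> ball 0 1" for z
  proof -
    have "((\<lambda>z. z * h z) has_field_derivative h z + z * deriv h z) (at z)"
      using holomorphic_derivI[OF h open_ball z] by (auto intro!: derivative_eq_intros)
    then have "(f has_field_derivative h z + z * deriv h z) (at z)"
      by (rule has_field_derivative_transform_within_open[of _ _ _ "ball 0 1"]) (use fh z in auto)
    with 0(3)[OF z] show ?thesis
      using DERIV_unique by fastforce
  qed
  with h fh show ?case
    by auto
next
  case (Suc k)
  have "\<exists>h. h holomorphic_on ball 0 1 \<and> (\<forall>z\<in>ball 0 1. f z = z ^ Suc k * h z \<and>
           of_nat (Suc k) * h z + z * deriv h z = z * F z)"
    using Suc.prems by (intro Suc.IH holomorphic_intros) (auto simp: mult_ac)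
  then obtain h0 where h0: "h0 holomorphic_on ball 0 1" and
    f0: "\<And>z. z \<in> ball 0 1 \<Longrightarrow> f z = z ^ Suc k * h0 z" and
    e0: "\<And>z. z \<in> ball 0 1 \<Longrightarrow> of_nat (Suc k) * h0 z + z * deriv h0 z = z * F z"
    by blast
  have "h0 0 = 0"
    using e0[of 0] by (auto simp del: of_nat_Suc)
  from Schwarz3[OF h0 this] obtain h where h: "h holomorphic_on ball 0 1"
    and fh: "\<And>z. norm z < 1 \<Longrightarrow> h0 z = z * h z"
    by metis
  have dh: "deriv h0 z = h z + z * deriv h z" if z: "z \<in> ball 0 1" for z
  proof (rule DERIV_imp_deriv)
    have "((\<lambda>z. z * h z) has_field_derivative h z + z * deriv h z) (at z)"
      using holomorphic_derivI[OF h open_ball z] by (auto intro!: derivative_eq_intros)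
    then show "(h0 has_field_derivative h z + z * deriv h z) (at z)"
      by (rule has_field_derivative_transform_within_open[of _ _ _ "ball 0 1"]) (use fh z in auto)
  qed
  have "of_nat (Suc (Suc k)) * h z + z * deriv h z = F z" if "z \<in> ball 0 1" for z
  proof (rule ident_mult_cancel[OF _ Suc.prems(1) _ that])
    show "(\<lambda>z. of_nat (Suc (Suc k)) * h z + z * deriv h z) holomorphic_on ball 0 1"
      by (intro holomorphic_intros h holomorphic_deriv) auto
    show "z * (of_nat (Suc (Suc k)) * h z + z * deriv h z) = z * F z" if "z \<in> ball 0 1" for z
      using e0[OF that] dh[OF that] fh[of z] that by (simp add: algebra_simps)
  qed
  with h f0 fh show ?case
    by (intro exI[of _ h]) auto
qed

text \<open>
  Convex functions are starlike, for zeros of order \<open>m\<close> at the origin: with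
  \<open>f(z) = z\<^sup>m g(z)\<close> and \<open>f'(z) = z\<^bsup>m-1\<^esup> G(z)\<close> the hypothesis is \<open>Re (1 + z f''/f') > 0\<close> and the
  conclusion is \<open>Re (f / (z f')) > 0\<close>. The function \<open>h = f / (z f')\<close> solves
  \<open>z h' = 1 - h Q\<close> with \<open>Q = 1 + z f''/f'\<close>. At the point supplied by the minimum principle \<open>h Q\<close> is
  a real number \<open>\<ge> 1\<close>, so \<open>h\<close> is a positive multiple of \<open>1/Q\<close> there.
\<close>
lemma Re_convex_imp_Re_starlike:
  assumes G: "G holomorphic_on ball 0 1" and nz: "\<And>z. z \<in> ball 0 1 \<Longrightarrow> G z \<noteq> 0"
    and g: "g holomorphic_on ball 0 1"
    and eq: "\<And>z. z \<in> ball 0 1 \<Longrightarrow> of_nat m * g z + z * deriv g z = G z"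
    and cvx: "\<And>z. z \<in> ball 0 1 \<Longrightarrow> Re (of_nat m + z * deriv G z / G z) > 0"
    and z: "z \<in> ball 0 1"
  shows "Re (g z / G z) > 0"
proof -
  let ?h = "\<lambda>z. g z / G z"
  have "?h holomorphic_on ball 0 1"
    using G nz g by (intro holomorphic_intros) auto
  from minimum_Re_disc[OF this z] obtain z1 k where z1: "z1 \<in> ball 0 1" and
    le: "Re (?h z1) \<le> Re (?h z)" and k: "k \<ge> 0" "z1 * deriv ?h z1 = - of_real k"
    by blast
  define Q where "Q = of_nat m + z1 * deriv G z1 / G z1"
  have dh: "deriv ?h z1 = (deriv g z1 * G z1 - g z1 * deriv G z1) / (G z1 * G z1)"
    using holomorphic_derivI[OF G open_ball z1] holomorphic_derivI[OF g open_ball z1] nz[OF z1]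
    by (intro DERIV_imp_deriv) (auto intro!: derivative_eq_intros)
  have "z1 * deriv ?h z1 = (z1 * deriv g z1) / G z1 - ?h z1 * (z1 * deriv G z1 / G z1)"
    unfolding dh using nz[OF z1] by (simp add: field_simps)
  also have "z1 * deriv g z1 = G z1 - of_nat m * g z1"
    using eq[OF z1] by (simp add: algebra_simps)
  finally have zdh: "z1 * deriv ?h z1 = (G z1 - of_nat m * g z1) / G z1 - ?h z1 * (z1 * deriv G z1 / G z1)" .
  have "?h z1 * Q = 1 - z1 * deriv ?h z1"
    unfolding zdh Q_def using nz[OF z1] by (simp add: field_simps)
  then have "?h z1 * Q = of_real (1 + k)"
    using k(2) by simp
  moreover have Q: "Re Q > 0"
    using cvx[OF z1] by (simp add: Q_def)
  moreover have "Q \<noteq> 0"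
    using Q by auto
  ultimately have "?h z1 = of_real (1 + k) / Q"
    by (simp add: field_simps)
  then have "Re (?h z1) = (1 + k) * (Re Q / (norm Q)\<^sup>2)"
    by (simp add: Re_divide cmod_power2)
  also have "\<dots> > 0"
    using k Q \<open>Q \<noteq> 0\<close> by simp
  finally show ?thesis
    using le by simp
qed

text \<open>The maximum modulus principle for \<open>exp (- q)\<close>.\<close>
lemma constant_of_minimum_Re:
  assumes q: "q holomorphic_on ball 0 1" and nonneg: "\<And>z. z \<in> ball 0 1 \<Longrightarrow> Re (q z) \<ge> 0"
    and z0: "z0 \<in> ball 0 1" "Re (q z0) = 0"
  shows "\<exists>a. \<forall>z\<in>ball 0 1. q z = a"
proof -
  let ?e = "\<lambda>z. exp (- q z)"
  have hol: "?e holomorphic_on ball 0 1"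
    by (intro holomorphic_intros q)
  have "?e constant_on ball 0 1"
    by (rule maximum_modulus_principle[OF hol open_ball _ open_ball order_refl z0(1)])
       (use nonneg z0 in auto)
  then obtain d where d: "\<And>z. z \<in> ball 0 1 \<Longrightarrow> ?e z = d"
    unfolding constant_on_def by auto
  have "(q has_field_derivative 0) (at z within ball 0 1)" if z: "z \<in> ball 0 1" for z
  proof -
    have "(?e has_field_derivative 0) (at z)"
      by (rule has_field_derivative_transform_within_open[of "\<lambda>_. d" _ _ "ball 0 1"]) (use d z in auto)
    moreover have "(?e has_field_derivative exp (- q z) * (- deriv q z)) (at z)"
      using holomorphic_derivI[OF q open_ball z] by (auto intro!: derivative_eq_intros)
    ultimately have "exp (- q z) * (- deriv q z) = 0"
      using DERIV_unique by blast
    then show ?thesis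
      using holomorphic_derivI[OF q open_ball z, of "ball 0 1"] by simp
  qed
  then show ?thesis
    using has_field_derivative_zero_constant[OF convex_ball] by blast
qed

text \<open>
  With \<open>q = n / g\<close> and \<open>h = g / G\<close> one has \<open>R = q + h z q'\<close>. At the point supplied by the minimum
  principle the last term is a nonpositive multiple of \<open>h\<close>, and \<open>Re h > 0\<close> by starlikeness,
  so \<open>Re q \<ge> Re R \<ge> 0\<close> there, and hence everywhere. If \<open>Re q\<close> attains the value \<open>0\<close>, then \<open>q\<close> is
  constant and \<open>R = q\<close>.
\<close>
lemma Re_quotient_of_primitives:
  assumes G: "G holomorphic_on ball 0 1" and nz: "\<And>z. z \<in> ball 0 1 \<Longrightarrow> G z \<noteq> 0"
    and g: "g holomorphic_on ball 0 1"
    and eq: "\<And>z. z \<in> ball 0 1 \<Longrightarrow> of_nat m * g z + z * deriv g z = G z"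
    and cvx: "\<And>z. z \<in> ball 0 1 \<Longrightarrow> Re (of_nat m + z * deriv G z / G z) > 0"
    and n: "n holomorphic_on ball 0 1"
    and eqn: "\<And>z. z \<in> ball 0 1 \<Longrightarrow> of_nat m * n z + z * deriv n z = G z * R z"
    and R: "\<And>z. z \<in> ball 0 1 \<Longrightarrow> Re (R z) \<ge> 0"
  shows "z \<in> ball 0 1 \<Longrightarrow> g z \<noteq> 0"
    and "z \<in> ball 0 1 \<Longrightarrow> Re (n z / g z) \<ge> 0"
    and "z0 \<in> ball 0 1 \<Longrightarrow> Re (n z0 / g z0) = 0 \<Longrightarrow> z \<in> ball 0 1 \<Longrightarrow> Re (R z) = 0"
proof -
  have h: "Re (g z / G z) > 0" if "z \<in> ball 0 1" for z
    using Re_convex_imp_Re_starlike[OF G nz g eq cvx that] .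
  show gnz: "g z \<noteq> 0" if "z \<in> ball 0 1" for z
    using h[OF that] by auto
  let ?q = "\<lambda>z. n z / g z"
  have q: "?q holomorphic_on ball 0 1"
    using g n gnz by (intro holomorphic_intros) auto
  have key: "R z = ?q z + g z / G z * (z * deriv ?q z)" if z: "z \<in> ball 0 1" for z
  proof -
    have "deriv ?q z = (deriv n z * g z - n z * deriv g z) / (g z * g z)"
      using holomorphic_derivI[OF n open_ball z] holomorphic_derivI[OF g open_ball z] gnz[OF z]
      by (intro DERIV_imp_deriv) (auto intro!: derivative_eq_intros)
    then have "z * deriv ?q z = ((z * deriv n z) * g z - n z * (z * deriv g z)) / (g z * g z)"
      by (simp add: algebra_simps)
    also have "z * deriv n z = G z * R z - of_nat m * n z"
      using eqn[OF z] by (simp add: algebra_simps)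
    also have "z * deriv g z = G z - of_nat m * g z"
      using eq[OF z] by (simp add: algebra_simps)
    finally show ?thesis
      using nz[OF z] gnz[OF z] by (simp add: field_simps)
  qed
  show nonneg: "Re (?q z) \<ge> 0" if z: "z \<in> ball 0 1" for z
  proof -
    from minimum_Re_disc[OF q z] obtain z1 k where z1: "z1 \<in> ball 0 1" and
      le: "Re (?q z1) \<le> Re (?q z)" and k: "k \<ge> 0" "z1 * deriv ?q z1 = - of_real k"
      by blast
    have "R z1 = ?q z1 - of_real k * (g z1 / G z1)"
      using key[OF z1] k by (simp add: mult.commute)
    then have "Re (R z1) = Re (?q z1) - k * Re (g z1 / G z1)"
      by (simp del: times_divide_eq_right)
    moreover have "k * Re (g z1 / G z1) \<ge> 0"
      using k h[OF z1] by (intro mult_nonneg_nonneg) auto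
    ultimately show ?thesis
      using R[OF z1] le by linarith
  qed
  assume z0: "z0 \<in> ball 0 1" "Re (?q z0) = 0" and z: "z \<in> ball 0 1"
  obtain a where a: "\<And>z. z \<in> ball 0 1 \<Longrightarrow> ?q z = a"
    using constant_of_minimum_Re[OF q nonneg z0] by blast
  have "(?q has_field_derivative 0) (at z)"
    by (rule has_field_derivative_transform_within_open[of "\<lambda>_. a" _ _ "ball 0 1"]) (use a z in auto)
  then have "deriv ?q z = 0"
    by (rule DERIV_imp_deriv)
  then show "Re (R z) = 0"
    using key[OF z] a[OF z] a[OF z0(1)] z0(2) by simp
qed

section \<open>The pointwise discs of values\<close>

text \<open>The inequality behind the disc automorphisms.\<close>
lemma norm_cnj_minus_less:
  assumes "norm a < 1" "norm z < 1"
  shows "norm (cnj a - z) < norm (1 - a * z)"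
proof -
  have "(norm (1 - a * z))\<^sup>2 - (norm (cnj a - z))\<^sup>2 = (1 - (norm a)\<^sup>2) * (1 - (norm z)\<^sup>2)"
    unfolding cmod_power2 by (simp add: power2_eq_square algebra_simps)
  also have "\<dots> > 0"
    using assms by (simp add: power_less_one_iff)
  finally show ?thesis
    using power2_less_imp_less[of "norm (cnj a - z)" "norm (1 - a * z)"] by simp
qed

lemma norm_delta_less_1:
  assumes "norm lam < 1" "norm z < 1"
  shows "1 + cnj lam * z \<noteq> 0" "norm (delta z lam) < 1"
proof -
  have less: "norm (z + lam) < norm (1 + cnj lam * z)"
    using norm_cnj_minus_less[of "- cnj lam" z] norm_minus_commute[of "-lam" z] assms by simp
  then show nz: "1 + cnj lam * z \<noteq> 0"
    by auto
  show "norm (delta z lam) < 1"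
    using less nz by (simp add: delta_def norm_divide)
qed

text \<open>
  With \<open>y = a z\<close> this is \<open>(1 + cnj lam * y) * (1 - delta y lam * z)\<close>, the denominator of
  \<open>H_fun \<gamma> \<beta> a lam z\<close> after clearing fractions.
\<close>
definition H_den :: "complex \<Rightarrow> complex \<Rightarrow> complex \<Rightarrow> complex" where
  "H_den lam z y = (1 - lam * z) + (cnj lam - z) * y"

definition coef :: "real \<Rightarrow> real \<Rightarrow> complex" where
  "coef \<gamma> \<beta> = 2 * (1 - of_real \<beta>) * cis (- \<gamma>) * of_real (cos \<gamma>)"

lemma H_fun_coef:
  "H_fun \<gamma> \<beta> a lam z = 1 + coef \<gamma> \<beta> * (delta (a * z) lam * z / (1 - delta (a * z) lam * z))"
  by (simp add: H_fun_def coef_def)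

lemma H_den_nonzero:
  assumes "norm lam < 1" "norm z < 1" "norm y \<le> 1"
  shows "H_den lam z y \<noteq> 0"
proof
  assume "H_den lam z y = 0"
  then have "norm (1 - lam * z) = norm ((cnj lam - z) * y)"
    by (metis add_eq_0_iff H_den_def norm_minus_cancel)
  also have "\<dots> \<le> norm (cnj lam - z)"
    using assms(3) by (simp add: norm_mult mult_left_le)
  finally show False
    using norm_cnj_minus_less[OF assms(1,2)] by simp
qed

lemma H_fun_eq:
  assumes "norm lam < 1" "norm z < 1" "norm a \<le> 1"
  shows "H_fun \<gamma> \<beta> a lam z = 1 + coef \<gamma> \<beta> * ((a * z + lam) * z / H_den lam z (a * z))"
proof -
  have az: "norm (a * z) < 1"
    using assms by (metis mult_left_le_one_le norm_ge_zero norm_mult order_le_less_trans)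
  have nz: "1 + cnj lam * (a * z) \<noteq> 0"
    using norm_delta_less_1[OF assms(1) az] by simp
  then have minus: "1 - delta (a * z) lam * z = H_den lam z (a * z) / (1 + cnj lam * (a * z))"
    by (simp add: delta_def H_den_def field_simps)
  have "delta (a * z) lam * z / (1 - delta (a * z) lam * z) = (a * z + lam) * z / H_den lam z (a * z)"
    unfolding minus using nz by (simp add: delta_def)
  then show ?thesis
    unfolding H_fun_coef by simp
qed

text \<open>
  The map \<open>a \<mapsto> H\<^sub>a(z)\<close> is a Moebius transformation, so a difference of two of its values is the
  product of the difference of the parameters, a constant, and the reciprocal denominators.
\<close>
lemma H_fun_diff:
  assumes "norm lam < 1" "norm z < 1" "norm a \<le> 1" "norm b \<le> 1"
  shows "H_fun \<gamma> \<beta> a lam z - H_fun \<gamma> \<beta> b lam z =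
    coef \<gamma> \<beta> * (1 - lam * cnj lam) * z\<^sup>2 * (a - b) / (H_den lam z (a * z) * H_den lam z (b * z))"
proof -
  have "norm (a * z) \<le> 1" "norm (b * z) \<le> 1"
    using assms by (auto simp: norm_mult mult_le_one)
  then have nz: "H_den lam z (a * z) \<noteq> 0" "H_den lam z (b * z) \<noteq> 0"
    using H_den_nonzero assms by auto
  have "(a * z + lam) * z / H_den lam z (a * z) - (b * z + lam) * z / H_den lam z (b * z)
    = ((a * z + lam) * z * H_den lam z (b * z) - (b * z + lam) * z * H_den lam z (a * z)) / (H_den lam z (a * z) * H_den lam z (b * z))"
    using nz by (simp add: diff_frac_eq)
  also have "(a * z + lam) * z * H_den lam z (b * z) - (b * z + lam) * z * H_den lam z (a * z) = (1 - lam * cnj lam) * z\<^sup>2 * (a - b)"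
    unfolding H_den_def by (simp add: power2_eq_square algebra_simps)
  finally show ?thesis
    unfolding H_fun_eq[OF assms(1,2,3)] H_fun_eq[OF assms(1,2,4)]
    by (metis (no_types, lifting) add_diff_cancel_left mult.assoc right_diff_distrib times_divide_eq_right)
qed

text \<open>
  The Moebius map in \<open>\<kappa>\<close> sends the unit disc to a disc in the right half-plane that touches the
  imaginary axis at \<open>0\<close>, the image of \<open>1\<close>. The identity for \<open>N\<close> in the proof makes this visible
  and identifies the case of equality.
\<close>
lemma Re_disc_to_half_plane:
  assumes "norm \<tau> < 1" "norm \<kappa> \<le> 1"
  shows "Re ((1 - \<kappa>) * (1 + \<tau>) / (1 + \<tau> * \<kappa>)) \<ge> 0"
    and "Re ((1 - \<kappa>) * (1 + \<tau>) / (1 + \<tau> * \<kappa>)) = 0 \<Longrightarrow> \<kappa> = 1"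
proof -
  define N where "N = (1 - (norm \<kappa>)\<^sup>2) * (norm (1 + \<tau>))\<^sup>2 + (1 - (norm \<tau>)\<^sup>2) * (norm (1 - \<kappa>))\<^sup>2"
  have eq: "2 * Re ((1 - \<kappa>) * (1 + \<tau>) * cnj (1 + \<tau> * \<kappa>)) = N"
    unfolding N_def cmod_power2 by (simp add: power2_eq_square algebra_simps)
  have k: "1 - (norm \<kappa>)\<^sup>2 \<ge> 0" and t: "1 - (norm \<tau>)\<^sup>2 > 0"
    using assms by (auto simp: power_le_one_iff power_less_one_iff)
  then have "N \<ge> 0"
    unfolding N_def by simp
  then show "Re ((1 - \<kappa>) * (1 + \<tau>) / (1 + \<tau> * \<kappa>)) \<ge> 0"
    using eq unfolding Re_complex_div_ge_0 by simp
  assume "Re ((1 - \<kappa>) * (1 + \<tau>) / (1 + \<tau> * \<kappa>)) = 0"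
  then have "N = 0"
    using eq unfolding Re_complex_div_eq_0 by simp
  then have "(1 - (norm \<tau>)\<^sup>2) * (norm (1 - \<kappa>))\<^sup>2 = 0"
    using k t unfolding N_def by (subst (asm) add_nonneg_eq_0_iff) auto
  then show "\<kappa> = 1"
    using t by simp
qed

text \<open>
  For \<open>z \<noteq> 0\<close> the quotient \<open>R\<close> is \<open>H\<^sub>\<eta>(z) - H\<^sub>a(z)\<close> divided by an outward normal at \<open>H\<^sub>\<eta>(z)\<close> of the disc
  of all \<open>H\<^sub>a(z)\<close>, \<open>|a| \<le> 1\<close>.
\<close>
lemma Re_H_den_quotient:
  assumes "norm lam < 1" "norm z < 1" "norm a \<le> 1" "norm \<eta> = 1"
  defines "R \<equiv> (1 - a * cnj \<eta>) * H_den lam z (\<eta> * z) / H_den lam z (a * z)"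
  shows "Re R \<ge> 0" and "Re R = 0 \<Longrightarrow> a = \<eta>"
proof -
  define \<tau> where "\<tau> = (cnj lam - z) * \<eta> * z / (1 - lam * z)"
  define \<kappa> where "\<kappa> = a * cnj \<eta>"
  have less: "norm (cnj lam - z) < norm (1 - lam * z)"
    using norm_cnj_minus_less assms by blast
  then have nz: "1 - lam * z \<noteq> 0"
    by auto
  have \<eta>: "\<eta> * cnj \<eta> = 1"
    using assms(4) by (simp add: complex_norm_square[symmetric])
  have "norm (cnj lam - z) * norm z \<le> norm (cnj lam - z)"
    using assms(2) by (simp add: mult_left_le)
  then have "norm \<tau> < 1"
    using less nz assms(4) by (simp add: \<tau>_def norm_divide norm_mult)
  moreover have "norm \<kappa> \<le> 1"
    using assms by (simp add: \<kappa>_def norm_mult)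
  moreover have d1: "H_den lam z (\<eta> * z) = (1 - lam * z) * (1 + \<tau>)"
    using nz by (simp add: H_den_def \<tau>_def field_simps)
  moreover have d2: "H_den lam z (a * z) = (1 - lam * z) * (1 + \<tau> * \<kappa>)"
  proof -
    have "(1 - lam * z) * (\<tau> * \<kappa>) = (cnj lam - z) * (a * z) * (\<eta> * cnj \<eta>)"
      using nz by (simp add: \<tau>_def \<kappa>_def)
    then show ?thesis
      using \<eta> by (simp add: H_den_def distrib_left)
  qed
  moreover have "R = (1 - \<kappa>) * (1 + \<tau>) / (1 + \<tau> * \<kappa>)"
    unfolding R_def d1 d2 \<kappa>_def[symmetric] using nz by simp
  ultimately have "Re R \<ge> 0" and *: "Re R = 0 \<Longrightarrow> \<kappa> = 1"
    using Re_disc_to_half_plane[of \<tau> \<kappa>] by auto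
  show "Re R \<ge> 0" by fact
  assume "Re R = 0"
  then have "a * (\<eta> * cnj \<eta>) = \<eta>"
    using * unfolding \<kappa>_def by (metis mult.assoc mult.commute mult.right_neutral)
  then show "a = \<eta>"
    using \<eta> by simp
qed

text \<open>
  The convexity of the majorant. Rotating by a square root \<open>\<mu>\<close> of \<open>\<eta>\<close> brings the denominator into the
  form \<open>1 - u\<^sup>2 + 2 \<i> s u\<close> with \<open>s\<close> real, \<open>|s| \<le> 1\<close>, and then
  \<open>Re ((1 + u\<^sup>2) cnj (1 - u\<^sup>2 + 2 \<i> s u)) = (1 - |u|\<^sup>2) (1 + |u|\<^sup>2 - 2 s Im u)\<close>, where the last factor
  is at least \<open>(1 - |u|)\<^sup>2\<close>.
\<close>
lemma Re_inverse_H_den: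
  assumes "norm lam < 1" "norm z < 1" "norm \<eta> = 1"
  shows "Re ((1 + \<eta> * z\<^sup>2) / H_den lam z (\<eta> * z)) > 0"
proof -
  define \<mu> where "\<mu> = csqrt \<eta>"
  have \<mu>: "\<mu>\<^sup>2 = \<eta>"
    by (simp add: \<mu>_def)
  then have "norm \<mu> ^ 2 = 1"
    using assms(3) by (metis norm_power)
  then have n\<mu>: "norm \<mu> = 1"
    by (simp add: power2_eq_1_iff) (metis norm_ge_zero not_one_le_zero neg_0_le_iff_le)
  then have cc: "\<mu> * cnj \<mu> = 1"
    by (simp add: complex_norm_square[symmetric])
  define u where "u = \<mu> * z"
  define s where "s = Im (cnj lam * \<mu>)"
  have u: "norm u < 1"
    using assms n\<mu> by (simp add: u_def norm_mult)
  have s: "\<bar>s\<bar> \<le> 1"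
    using abs_Im_le_cmod[of "cnj lam * \<mu>"] assms n\<mu> by (simp add: s_def norm_mult)
  have e1: "\<eta> * z\<^sup>2 = u\<^sup>2"
    by (simp add: u_def power_mult_distrib \<mu>)
  have "H_den lam z (\<eta> * z) = 1 - u\<^sup>2 + (cnj lam * \<mu> - cnj (cnj lam * \<mu>)) * u"
  proof -
    have "cnj \<mu> * u = z * (\<mu> * cnj \<mu>)"
      by (simp add: u_def)
    then have "cnj \<mu> * u = z"
      using cc by simp
    moreover have "\<mu> * u = \<eta> * z"
      by (simp add: u_def power2_eq_square flip: \<mu>)
    ultimately show ?thesis
      using e1 by (simp add: H_den_def algebra_simps power2_eq_square)
  qed
  also have "cnj lam * \<mu> - cnj (cnj lam * \<mu>) = 2 * \<i> * of_real s"
    by (simp add: complex_eq_iff s_def)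
  finally have e2: "H_den lam z (\<eta> * z) = 1 - u\<^sup>2 + 2 * \<i> * of_real s * u" .
  have "Re ((1 + u\<^sup>2) * cnj (H_den lam z (\<eta> * z))) = (1 - (norm u)\<^sup>2) * (1 + (norm u)\<^sup>2 - 2 * s * Im u)"
    unfolding e2 cmod_power2 by (simp add: power2_eq_square algebra_simps)
  moreover have "(1 - (norm u)\<^sup>2) * (1 + (norm u)\<^sup>2 - 2 * s * Im u) > 0"
  proof (rule mult_pos_pos)
    show "1 - (norm u)\<^sup>2 > 0"
      using u by (simp add: power_less_one_iff)
    have "s * Im u \<le> \<bar>s\<bar> * \<bar>Im u\<bar>"
      by (metis abs_ge_self abs_mult)
    also have "\<dots> \<le> 1 * norm u"
      using s abs_Im_le_cmod by (intro mult_mono) auto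
    finally have "1 + (norm u)\<^sup>2 - 2 * s * Im u \<ge> (1 - norm u)\<^sup>2"
      by (simp add: power2_eq_square algebra_simps)
    moreover have "(1 - norm u)\<^sup>2 > 0"
      using u by simp
    ultimately show "1 + (norm u)\<^sup>2 - 2 * s * Im u > 0"
      by linarith
  qed
  moreover have "H_den lam z (\<eta> * z) \<noteq> 0"
    using H_den_nonzero assms by (simp add: norm_mult)
  ultimately show ?thesis
    unfolding e1 Re_complex_div_gt_0 by simp
qed

section \<open>Parametrization of the class by Schwarz functions\<close>

lemma coef_eq: "coef \<gamma> \<beta> = of_real (2 * (1 - \<beta>) * cos \<gamma>) * cis (- \<gamma>)"
  by (simp add: coef_def)

lemma cos_pos_of_abs_less: "\<bar>\<gamma>\<bar> < pi / 2 \<Longrightarrow> cos \<gamma> > 0"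
  by (intro cos_gt_zero_pi) auto

lemma coef_nonzero: "\<beta> < 1 \<Longrightarrow> \<bar>\<gamma>\<bar> < pi / 2 \<Longrightarrow> coef \<gamma> \<beta> \<noteq> 0"
  using cos_pos_of_abs_less[of \<gamma>] by (simp add: coef_eq)

text \<open>
  After multiplication by \<open>e\<^bsup>i\<gamma>\<^esup>\<close> the defining inequality is, up to a positive factor,
  \<open>Re ((1 + w) / (1 - w)) > 0\<close>.
\<close>
lemma class_P_atI:
  assumes "\<beta> < 1" "\<bar>\<gamma>\<bar> < pi / 2"
    and w: "w holomorphic_on ball 0 1" "w 0 = 0" "\<And>z. z \<in> ball 0 1 \<Longrightarrow> norm (w z) < 1"
    and P: "\<And>z. z \<in> ball 0 1 \<Longrightarrow> P z = 1 + coef \<gamma> \<beta> * (w z / (1 - w z))"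
  shows "P \<in> class_P_at \<gamma> \<beta> (deriv w 0)"
proof -
  define d where "d = 2 * (1 - \<beta>) * cos \<gamma>"
  have d: "d > 0"
    using assms(1) cos_pos_of_abs_less[OF assms(2)] by (simp add: d_def)
  have nz: "1 - w z \<noteq> 0" if "z \<in> ball 0 1" for z
    using w(3)[OF that] by auto
  have "(\<lambda>z. 1 + coef \<gamma> \<beta> * (w z / (1 - w z))) holomorphic_on ball 0 1"
    using nz by (intro holomorphic_intros w) auto
  then have "P holomorphic_on ball 0 1"
    by (rule holomorphic_transform) (use P in auto)
  moreover have "P 0 = 1"
    using P[of 0] w by simp
  moreover have "Re (cis \<gamma> * P z) > \<beta> * cos \<gamma>" if z: "z \<in> ball 0 1" for z
  proof -
    have "Re (2 * (w z / (1 - w z)) + 1) = Re ((1 + w z) / (1 - w z))"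
      using nz[OF z] by (simp add: field_simps)
    also have "\<dots> > 0"
    proof -
      have "Re ((1 + w z) * cnj (1 - w z)) = 1 - (norm (w z))\<^sup>2"
        unfolding cmod_power2 by (simp add: power2_eq_square algebra_simps)
      also have "\<dots> > 0"
        using w(3)[OF z] by (simp add: power_less_one_iff)
      finally show ?thesis
        unfolding Re_complex_div_gt_0 .
    qed
    finally have *: "2 * Re (w z / (1 - w z)) + 1 > 0"
      by (simp del: times_divide_eq_right)
    have "cis \<gamma> * P z = cis \<gamma> + of_real d * (w z / (1 - w z))"
      using P[OF z] by (simp add: coef_eq d_def distrib_left cis_mult mult.left_commute[of _ "cis \<gamma>"]
          flip: mult.assoc)
    then have "Re (cis \<gamma> * P z) = cos \<gamma> + d * Re (w z / (1 - w z))"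
      by (simp del: times_divide_eq_right)
    moreover have "d / 2 * (2 * Re (w z / (1 - w z)) + 1) > 0"
      using d * by simp
    ultimately show ?thesis
      by (simp add: d_def algebra_simps)
  qed
  moreover have "deriv P 0 = coef \<gamma> \<beta> * deriv w 0"
  proof (rule DERIV_imp_deriv)
    have "((\<lambda>z. 1 + coef \<gamma> \<beta> * (w z / (1 - w z))) has_field_derivative coef \<gamma> \<beta> * deriv w 0) (at 0)"
      using holomorphic_derivI[OF w(1) open_ball, of 0] w(2) by (auto intro!: derivative_eq_intros)
    then show "(P has_field_derivative coef \<gamma> \<beta> * deriv w 0) (at 0)"
      by (rule has_field_derivative_transform_within_open[of _ _ _ "ball 0 1"]) (use P in auto)
  qed
  ultimately show ?thesis
    by (simp add: class_P_at_def class_P_def coef_def mult_ac)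
qed

lemma H_fun_in_class_P_at:
  assumes "\<beta> < 1" "\<bar>\<gamma>\<bar> < pi / 2" "norm lam < 1" "norm a \<le> 1"
  shows "H_fun \<gamma> \<beta> a lam \<in> class_P_at \<gamma> \<beta> lam"
proof -
  define D where "D = (\<lambda>z. delta (a * z) lam)"
  have az: "norm (a * z) < 1" if "z \<in> ball 0 1" for z
    using assms that by (metis mem_ball_0 mult_left_le_one_le norm_ge_zero norm_mult order_le_less_trans)
  note D = norm_delta_less_1[OF assms(3) az]
  have hol: "D holomorphic_on ball 0 1"
    unfolding D_def delta_def using D(1) by (intro holomorphic_intros) auto
  let ?w = "\<lambda>z. D z * z"
  have "deriv ?w 0 = lam"
    using holomorphic_derivI[OF hol open_ball, of 0]
    by (intro DERIV_imp_deriv) (auto intro!: derivative_eq_intros simp: D_def delta_def)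
  moreover have "norm (?w z) < 1" if "z \<in> ball 0 1" for z
  proof -
    have "norm (?w z) \<le> norm (D z)"
      using that by (simp add: norm_mult mult_left_le)
    then show ?thesis
      using D(2)[OF that] by (simp add: D_def)
  qed
  then have "H_fun \<gamma> \<beta> a lam \<in> class_P_at \<gamma> \<beta> (deriv ?w 0)"
    by (intro class_P_atI assms holomorphic_intros hol) (auto simp: H_fun_coef D_def)
  ultimately show ?thesis
    by simp
qed

text \<open>
  The Schwarz lemma, stated for the quotient \<open>f(z) / z\<close>. If \<open>|f'(0)| < 1\<close>, then \<open>f\<close> is not a
  rotation, and the quotient stays in the open disc.
\<close>
lemma Schwarz_factor:
  assumes f: "f holomorphic_on ball 0 1" "f 0 = 0" "\<And>z. norm z < 1 \<Longrightarrow> norm (f z) < 1"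
  obtains h where "h holomorphic_on ball 0 1" "\<And>z. norm z < 1 \<Longrightarrow> f z = z * h z"
    "deriv f 0 = h 0" "\<And>z. norm z < 1 \<Longrightarrow> norm (h z) \<le> 1"
    "\<And>z. norm (h 0) < 1 \<Longrightarrow> norm z < 1 \<Longrightarrow> norm (h z) < 1"
proof -
  from Schwarz3[OF f(1,2)] obtain h where h: "h holomorphic_on ball 0 1"
    and fh: "\<And>z. norm z < 1 \<Longrightarrow> f z = z * h z" and h0: "deriv f 0 = h 0"
    by metis
  have le: "norm (h z) \<le> 1" if z: "norm z < 1" for z
  proof (cases "z = 0")
    case True
    then show ?thesis
      using Schwarz_Lemma(2)[OF f z] h0 by simp
  next
    case False
    then show ?thesis
      using Schwarz_Lemma(1)[OF f z] fh[OF z] by (simp add: norm_mult)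
  qed
  have "norm (h z) < 1" if h1: "norm (h 0) < 1" and z: "norm z < 1" for z
  proof (rule ccontr)
    assume "\<not> norm (h z) < 1"
    then have n: "norm (h z) = 1" and nz: "z \<noteq> 0"
      using le[OF z] h1 by auto
    then have "norm (f z) = norm z"
      using fh[OF z] by (simp add: norm_mult)
    then obtain \<alpha> where \<alpha>: "\<And>z. norm z < 1 \<Longrightarrow> f z = \<alpha> * z" "norm \<alpha> = 1"
      using Schwarz_Lemma(3)[OF f z] z nz by blast
    have "(f has_field_derivative \<alpha>) (at 0)"
      by (rule has_field_derivative_transform_within_open[of "\<lambda>z. \<alpha> * z" _ _ "ball 0 1"])
         (use \<alpha> in \<open>auto intro!: derivative_eq_intros\<close>)
    then show False
      using h0 h1 \<alpha>(2) by (simp add: DERIV_imp_deriv)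
  qed
  then show ?thesis
    using that h fh h0 le by blast
qed

text \<open>
  The first application of the Schwarz lemma is to \<open>w = (P - 1) / (P - 1 + c)\<close>, which gives
  \<open>w = z g\<close> with \<open>g(0) = lam\<close>; the second one is to the disc automorphism that moves \<open>lam\<close> to
  \<open>0\<close>, applied to \<open>g\<close>. It gives \<open>z k\<close>, whence \<open>g(z) = delta (z k(z)) lam\<close>.
\<close>
lemma class_P_at_cases:
  assumes "\<beta> < 1" "\<bar>\<gamma>\<bar> < pi / 2" "norm lam < 1" and P: "P \<in> class_P_at \<gamma> \<beta> lam"
  obtains k where "k holomorphic_on ball 0 1" "\<And>z. norm z < 1 \<Longrightarrow> norm (k z) \<le> 1"
    "\<And>z. norm z < 1 \<Longrightarrow> P z = H_fun \<gamma> \<beta> (k z) lam z"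
proof -
  let ?c = "coef \<gamma> \<beta>"
  define d where "d = 2 * (1 - \<beta>) * cos \<gamma>"
  have d: "d > 0"
    using assms(1) cos_pos_of_abs_less[OF assms(2)] by (simp add: d_def)
  have c: "?c \<noteq> 0"
    using coef_nonzero assms by blast
  have holP: "P holomorphic_on ball 0 1" and P0: "P 0 = 1" and dP: "deriv P 0 = ?c * lam"
    and Re: "\<And>z. norm z < 1 \<Longrightarrow> Re (cis \<gamma> * P z) > \<beta> * cos \<gamma>"
    using P by (auto simp: class_P_at_def class_P_def coef_def mult_ac)
  have less: "norm (P z - 1) < norm (P z - 1 + ?c)" if z: "norm z < 1" for z
  proof -
    define u where "u = cis \<gamma> * (P z - 1)"
    have "cis \<gamma> * (P z - 1 + ?c) = u + of_real d"
      by (simp add: u_def coef_eq d_def distrib_left cis_mult mult.left_commute[of _ "cis \<gamma>"])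
    then have n2: "norm (P z - 1 + ?c) = norm (u + of_real d)"
      by (metis mult_1 norm_cis norm_mult)
    have n1: "norm (P z - 1) = norm u"
      by (simp add: u_def norm_mult)
    have "2 * Re u + d > 0"
      using Re[OF z] by (simp add: u_def d_def algebra_simps)
    then have "d * (2 * Re u + d) > 0"
      using d by simp
    then have "(norm u)\<^sup>2 < (norm (u + of_real d))\<^sup>2"
      unfolding cmod_power2 by (simp add: power2_eq_square algebra_simps)
    then show ?thesis
      unfolding n1 n2 by (rule power2_less_imp_less) simp
  qed
  have nz: "P z - 1 + ?c \<noteq> 0" if "norm z < 1" for z
    using less[OF that] by auto
  let ?w = "\<lambda>z. (P z - 1) / (P z - 1 + ?c)"
  have w: "?w holomorphic_on ball 0 1"
    using nz by (intro holomorphic_intros holP) auto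
  have w1: "norm (?w z) < 1" if "norm z < 1" for z
    using less[OF that] nz[OF that] by (simp add: norm_divide)
  have dw: "deriv ?w 0 = lam"
    using holomorphic_derivI[OF holP open_ball, of 0] c P0 dP
    by (intro DERIV_imp_deriv) (auto intro!: derivative_eq_intros)
  obtain g where g: "g holomorphic_on ball 0 1" and wg: "\<And>z. norm z < 1 \<Longrightarrow> ?w z = z * g z"
    and "deriv ?w 0 = g 0" and "\<And>z. norm (g 0) < 1 \<Longrightarrow> norm z < 1 \<Longrightarrow> norm (g z) < 1"
    by (rule Schwarz_factor[OF w _ w1]) (simp_all add: P0)
  then have g0: "g 0 = lam" and g1: "\<And>z. norm z < 1 \<Longrightarrow> norm (g z) < 1"
    using dw assms by auto
  have less': "norm (g z - lam) < norm (1 - cnj lam * g z)" if "norm z < 1" for z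
    using norm_cnj_minus_less[of "cnj lam" "g z"] g1[OF that] assms by (simp add: norm_minus_commute)
  have nz': "1 - cnj lam * g z \<noteq> 0" if "norm z < 1" for z
    using less'[OF that] by auto
  let ?y = "\<lambda>z. (g z - lam) / (1 - cnj lam * g z)"
  have y: "?y holomorphic_on ball 0 1"
    using nz' by (intro holomorphic_intros g) auto
  have y1: "norm (?y z) < 1" if "norm z < 1" for z
    using less'[OF that] nz'[OF that] by (simp add: norm_divide)
  obtain k where k: "k holomorphic_on ball 0 1" and yk: "\<And>z. norm z < 1 \<Longrightarrow> ?y z = z * k z"
    and k1: "\<And>z. norm z < 1 \<Longrightarrow> norm (k z) \<le> 1"
    by (rule Schwarz_factor[OF y _ y1]) (simp_all add: g0)
  have "P z = H_fun \<gamma> \<beta> (k z) lam z" if z: "norm z < 1" for z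
  proof -
    have l: "1 - cnj lam * lam \<noteq> 0"
      using norm_cnj_minus_less[of "cnj lam" lam] assms by auto
    have "1 + cnj lam * ?y z = (1 - cnj lam * lam) / (1 - cnj lam * g z)"
      using nz'[OF z] by (simp add: field_simps)
    moreover have "?y z + lam = g z * (1 - cnj lam * lam) / (1 - cnj lam * g z)"
      using nz'[OF z] by (simp add: field_simps)
    ultimately have "delta (?y z) lam = g z"
      unfolding delta_def using l nz'[OF z] by simp
    then have "delta (k z * z) lam * z = ?w z"
      using yk[OF z] wg[OF z] by (simp add: mult.commute)
    moreover have "1 - ?w z = ?c / (P z - 1 + ?c)"
      using nz[OF z] by (simp add: field_simps)
    ultimately have "delta (k z * z) lam * z / (1 - delta (k z * z) lam * z) = (P z - 1) / ?c"
      using nz[OF z] by simp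
    then show ?thesis
      unfolding H_fun_coef using c by simp
  qed
  then show ?thesis
    using that k k1 by blast
qed

lemma convex_combination_in_class_P_at:
  assumes P: "P \<in> class_P_at \<gamma> \<beta> lam" and Q: "Q \<in> class_P_at \<gamma> \<beta> lam"
    and uv: "u \<ge> 0" "v \<ge> 0" "u + v = 1"
  shows "(\<lambda>z. of_real u * P z + of_real v * Q z) \<in> class_P_at \<gamma> \<beta> lam"
proof -
  have holP: "P holomorphic_on ball 0 1" and holQ: "Q holomorphic_on ball 0 1"
    using P Q by (auto simp: class_P_at_def class_P_def)
  have uv1: "of_real u + of_real v = (1::complex)"
    using uv by (metis of_real_1 of_real_add)
  have "deriv (\<lambda>z. of_real u * P z + of_real v * Q z) 0 = of_real u * deriv P 0 + of_real v * deriv Q 0"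
    using holomorphic_derivI[OF holP open_ball, of 0] holomorphic_derivI[OF holQ open_ball, of 0]
    by (intro DERIV_imp_deriv) (auto intro!: derivative_eq_intros)
  also have "\<dots> = (of_real u + of_real v) * (2 * (1 - of_real \<beta>) * cis (- \<gamma>) * lam * of_real (cos \<gamma>))"
    using P Q unfolding class_P_at_def by (simp add: distrib_right)
  finally have "deriv (\<lambda>z. of_real u * P z + of_real v * Q z) 0 = 2 * (1 - of_real \<beta>) * cis (- \<gamma>) * lam * of_real (cos \<gamma>)"
    unfolding uv1 by simp
  moreover have "Re (cis \<gamma> * (of_real u * P z + of_real v * Q z)) > \<beta> * cos \<gamma>" if "z \<in> ball 0 1" for z
  proof -
    have "\<beta> * cos \<gamma> < Re (cis \<gamma> * P z)" "\<beta> * cos \<gamma> < Re (cis \<gamma> * Q z)"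
      using P Q that unfolding class_P_at_def class_P_def by blast+
    then have "- Re (cis \<gamma> * P z) < - (\<beta> * cos \<gamma>)" "- Re (cis \<gamma> * Q z) < - (\<beta> * cos \<gamma>)"
      by linarith+
    from convex_bound_lt[OF this uv] show ?thesis
      by (simp add: algebra_simps)
  qed
  moreover have "(\<lambda>z. of_real u * P z + of_real v * Q z) holomorphic_on ball 0 1"
    by (intro holomorphic_intros holP holQ)
  ultimately show ?thesis
    using P Q uv1 unfolding class_P_at_def class_P_def by simp
qed

lemma convex_V_P:
  assumes "z0 \<in> ball 0 1"
  shows "convex (V_P \<gamma> \<beta> z0 lam)"
proof (rule convexI)
  fix x y :: complex and u v :: real
  assume "x \<in> V_P \<gamma> \<beta> z0 lam" "y \<in> V_P \<gamma> \<beta> z0 lam" and uv: "0 \<le> u" "0 \<le> v" "u + v = 1"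
  then obtain P Q where P: "P \<in> class_P_at \<gamma> \<beta> lam" and Q: "Q \<in> class_P_at \<gamma> \<beta> lam"
    and xy: "x = contour_integral (linepath 0 z0) P" "y = contour_integral (linepath 0 z0) Q"
    unfolding V_P_def by auto
  have "closed_segment 0 z0 \<subseteq> ball 0 1"
    using assms by (intro closed_segment_subset) auto
  then have int: "F contour_integrable_on linepath 0 z0" if "F \<in> class_P_at \<gamma> \<beta> lam" for F
    using that by (intro contour_integrable_holomorphic_simple[of F "ball 0 1"]) (auto simp: class_P_at_def class_P_def)
  have "u *\<^sub>R x + v *\<^sub>R y = contour_integral (linepath 0 z0) (\<lambda>z. of_real u * P z + of_real v * Q z)"
    using int[OF P] int[OF Q] xy
    by (simp add: contour_integral_add contour_integral_lmul contour_integrable_lmul scaleR_conv_of_real)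
  then show "u *\<^sub>R x + v *\<^sub>R y \<in> V_P \<gamma> \<beta> z0 lam"
    unfolding V_P_def using convex_combination_in_class_P_at[OF P Q uv] by blast
qed

section \<open>The half-planes that support the region of variability\<close>

lemma contour_integral_linepath_disc_factor:
  assumes z0: "z0 \<in> ball 0 1" and F: "F holomorphic_on ball 0 1"
  obtains h where "h holomorphic_on ball 0 1"
    "\<And>z. z \<in> ball 0 1 \<Longrightarrow> of_nat (Suc k) * h z + z * deriv h z = F z"
    "contour_integral (linepath 0 z0) (\<lambda>z. z ^ k * F z) = z0 ^ Suc k * h z0"
proof -
  have hol: "(\<lambda>z. z ^ k * F z) holomorphic_on ball 0 1"
    by (intro holomorphic_intros F)
  obtain f0 where f0: "\<And>z. z \<in> ball 0 1 \<Longrightarrow> (f0 has_field_derivative z ^ k * F z) (at z within ball 0 1)"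
    using holomorphic_convex_primitive'[OF convex_ball open_ball hol] by blast
  define f where "f = (\<lambda>z. f0 z - f0 0)"
  have f: "(f has_field_derivative z ^ k * F z) (at z)" if "z \<in> ball 0 1" for z
    using f0[OF that] at_within_open[OF that open_ball] unfolding f_def
    by (auto intro!: derivative_eq_intros)
  have "\<exists>h. h holomorphic_on ball 0 1 \<and> (\<forall>z\<in>ball 0 1. f z = z ^ Suc k * h z \<and>
           of_nat (Suc k) * h z + z * deriv h z = F z)"
    by (rule primitive_factor[OF F _ f]) (simp_all add: f_def)
  then obtain h where h: "h holomorphic_on ball 0 1" "\<And>z. z \<in> ball 0 1 \<Longrightarrow> f z = z ^ Suc k * h z"
    "\<And>z. z \<in> ball 0 1 \<Longrightarrow> of_nat (Suc k) * h z + z * deriv h z = F z"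
    by blast
  have "closed_segment 0 z0 \<subseteq> ball 0 1"
    using z0 by (intro closed_segment_subset) auto
  then have "((\<lambda>z. z ^ k * F z) has_contour_integral (f z0 - f 0)) (linepath 0 z0)"
    using contour_integral_primitive[of "ball 0 1" f "\<lambda>z. z ^ k * F z" "linepath 0 z0"] f
    by (auto intro: has_field_derivative_at_within)
  then have "contour_integral (linepath 0 z0) (\<lambda>z. z ^ k * F z) = f z0"
    by (simp add: contour_integral_unique f_def)
  then show ?thesis
    using that h z0 by simp
qed

text \<open>
  The direction is \<open>D = M(z0)\<close>, where \<open>M(0) = 0\<close> and
  \<open>M'(z) = c (1 - |lam|\<^sup>2) \<eta> z\<^sup>2 / E(z)\<^sup>2\<close>; the \<open>G\<close> of the proof is \<open>M'(z) / z\<^sup>2\<close>. The difference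
  \<open>H\<^sub>\<eta> - P\<close> vanishes at \<open>0\<close> to second order because the values and first derivatives at \<open>0\<close>
  are prescribed; so both primitives have the factor \<open>z\<^sup>3\<close>, and the comparison principle
  applies with \<open>m = 3\<close>.
\<close>
lemma supporting_direction:
  assumes "\<beta> < 1" "\<bar>\<gamma>\<bar> < pi / 2" "norm lam < 1" "z0 \<in> ball 0 1" "z0 \<noteq> 0" "norm \<eta> = 1"
  obtains D where "D \<noteq> 0"
    "\<And>P. P \<in> class_P_at \<gamma> \<beta> lam \<Longrightarrow>
       Re ((contour_integral (linepath 0 z0) (H_fun \<gamma> \<beta> \<eta> lam) - contour_integral (linepath 0 z0) P) / D) \<ge> 0"
    "\<And>P z. P \<in> class_P_at \<gamma> \<beta> lam \<Longrightarrow>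
       Re ((contour_integral (linepath 0 z0) (H_fun \<gamma> \<beta> \<eta> lam) - contour_integral (linepath 0 z0) P) / D) = 0 \<Longrightarrow>
       z \<in> ball 0 1 \<Longrightarrow> P z = H_fun \<gamma> \<beta> \<eta> lam z"
proof -
  let ?I = "contour_integral (linepath 0 z0)"
  define C where "C = coef \<gamma> \<beta> * (1 - lam * cnj lam) * \<eta>"
  define E where "E = (\<lambda>z. H_den lam z (\<eta> * z))"
  define G where "G = (\<lambda>z. C / (E z)\<^sup>2)"
  have \<eta>: "\<eta> * cnj \<eta> = 1"
    using assms(6) by (simp add: complex_norm_square[symmetric])
  have "1 - lam * cnj lam \<noteq> 0"
    using norm_cnj_minus_less[of lam "cnj lam"] assms by auto
  then have C: "C \<noteq> 0"
    using coef_nonzero assms unfolding C_def by auto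
  have Enz: "E z \<noteq> 0" if "z \<in> ball 0 1" for z
    unfolding E_def using that assms by (intro H_den_nonzero) (auto simp: norm_mult)
  have holG: "G holomorphic_on ball 0 1"
    unfolding G_def using Enz unfolding E_def H_den_def by (intro holomorphic_intros) auto
  have Gnz: "G z \<noteq> 0" if "z \<in> ball 0 1" for z
    using C Enz[OF that] by (simp add: G_def)
  have cvx: "Re (of_nat (Suc 2) + z * deriv G z / G z) > 0" if z: "z \<in> ball 0 1" for z
  proof -
    define E' where "E' = - lam + cnj lam * \<eta> - 2 * \<eta> * z"
    have "(E has_field_derivative E') (at z)"
      unfolding E_def H_den_def E'_def by (auto intro!: derivative_eq_intros simp: algebra_simps)
    then have "(G has_field_derivative - 2 * C * E' / E z ^ 3) (at z)"
      unfolding G_def using Enz[OF z]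
      by (auto intro!: derivative_eq_intros simp: field_simps power2_eq_square power3_eq_cube)
    then have dG: "deriv G z = - 2 * C * E' / E z ^ 3"
      by (rule DERIV_imp_deriv)
    \<comment> \<open>\<open>3 - 2 z E'/E = 1 + 2 (E - z E') / E\<close>, and \<open>E - z E'\<close> contains neither \<open>lam\<close> nor \<open>cnj lam\<close>.\<close>
    have zE: "E z - z * E' = 1 + \<eta> * z\<^sup>2"
      by (simp add: E_def E'_def H_den_def algebra_simps power2_eq_square)
    have "of_nat (Suc 2) + z * deriv G z / G z = 1 + 2 * ((E z - z * E') / E z)"
      unfolding dG unfolding G_def using C Enz[OF z] by (simp add: field_simps power2_eq_square power3_eq_cube)
    also have "Re \<dots> = 1 + 2 * Re ((1 + \<eta> * z\<^sup>2) / E z)"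
      unfolding zE by (simp del: times_divide_eq_right)
    also have "\<dots> > 0"
      using Re_inverse_H_den[OF assms(3) _ assms(6), of z] z unfolding E_def by simp
    finally show ?thesis .
  qed
  obtain g where g: "g holomorphic_on ball 0 1"
    and eqg: "\<And>z. z \<in> ball 0 1 \<Longrightarrow> of_nat (Suc 2) * g z + z * deriv g z = G z"
    using contour_integral_linepath_disc_factor[OF assms(4) holG, of 2] by metis
  have main: "Re ((?I (H_fun \<gamma> \<beta> \<eta> lam) - ?I P) / (z0 ^ Suc 2 * g z0)) \<ge> 0 \<and> g z0 \<noteq> 0 \<and>
     (Re ((?I (H_fun \<gamma> \<beta> \<eta> lam) - ?I P) / (z0 ^ Suc 2 * g z0)) = 0 \<longrightarrow>
       (\<forall>z\<in>ball 0 1. P z = H_fun \<gamma> \<beta> \<eta> lam z))"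
    if P: "P \<in> class_P_at \<gamma> \<beta> lam" for P
  proof -
    let ?H = "H_fun \<gamma> \<beta> \<eta> lam"
    obtain k where k: "k holomorphic_on ball 0 1" and k1: "\<And>z. norm z < 1 \<Longrightarrow> norm (k z) \<le> 1"
      and Pk: "\<And>z. norm z < 1 \<Longrightarrow> P z = H_fun \<gamma> \<beta> (k z) lam z"
      using class_P_at_cases[OF assms(1-3) P] by metis
    define R where "R = (\<lambda>z. (1 - k z * cnj \<eta>) * E z / H_den lam z (k z * z))"
    have dnz: "H_den lam z (k z * z) \<noteq> 0" if "z \<in> ball 0 1" for z
      using that assms k1[of z] by (intro H_den_nonzero) (auto simp: norm_mult mult_le_one)
    have R: "Re (R z) \<ge> 0" and R0: "Re (R z) = 0 \<Longrightarrow> k z = \<eta>" if "z \<in> ball 0 1" for z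
      using Re_H_den_quotient[OF assms(3) _ k1 assms(6), of z] that unfolding R_def E_def by auto
    have holGR: "(\<lambda>z. G z * R z) holomorphic_on ball 0 1"
      unfolding R_def E_def using dnz unfolding H_den_def by (intro holomorphic_intros holG k) auto
    have diff: "?H z - P z = z\<^sup>2 * (G z * R z)" if z: "z \<in> ball 0 1" for z
    proof -
      have "\<eta> - k z = \<eta> * (1 - k z * cnj \<eta>)"
        using \<eta> by (simp add: right_diff_distrib mult.left_commute)
      then show ?thesis
        using H_fun_diff[of lam z \<eta> "k z" \<gamma> \<beta>] z assms k1[of z] Pk[of z] Enz[OF z]
        by (simp add: G_def R_def C_def E_def power2_eq_square mult_ac)
    qed
    obtain n where n: "n holomorphic_on ball 0 1"
      and eqn: "\<And>z. z \<in> ball 0 1 \<Longrightarrow> of_nat (Suc 2) * n z + z * deriv n z = G z * R z"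
      and In: "?I (\<lambda>z. z ^ 2 * (G z * R z)) = z0 ^ Suc 2 * n z0"
      by (rule contour_integral_linepath_disc_factor[OF assms(4) holGR, of 2]) blast
    have seg: "closed_segment 0 z0 \<subseteq> ball 0 1"
      using assms by (intro closed_segment_subset) auto
    then have int: "F contour_integrable_on linepath 0 z0" if "F \<in> class_P_at \<gamma> \<beta> lam" for F
      using that by (intro contour_integrable_holomorphic_simple[of F "ball 0 1"]) (auto simp: class_P_at_def class_P_def)
    have "?I ?H - ?I P = ?I (\<lambda>z. ?H z - P z)"
      using H_fun_in_class_P_at[OF assms(1-3), of \<eta>] assms(6) int P by (simp add: contour_integral_diff)
    also have "\<dots> = z0 ^ Suc 2 * n z0"
      unfolding In[symmetric] using seg by (intro contour_integral_cong) (auto simp: diff)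
    finally have q: "(?I ?H - ?I P) / (z0 ^ Suc 2 * g z0) = n z0 / g z0"
      using assms(5) by simp
    note cmp = Re_quotient_of_primitives[OF holG Gnz g eqg cvx n eqn R assms(4)]
    have "g z0 \<noteq> 0"
      by (rule cmp(1))
    moreover have "Re (n z0 / g z0) \<ge> 0"
      by (rule cmp(2))
    moreover have "P z = ?H z" if "Re (n z0 / g z0) = 0" and z: "z \<in> ball 0 1" for z
    proof -
      have "Re (R z) = 0"
        by (rule cmp(3)) (use that in auto)
      then show ?thesis
        using R0[OF z] Pk[of z] z by simp
    qed
    ultimately show ?thesis
      unfolding q by blast
  qed
  have "g z0 \<noteq> 0"
    using main H_fun_in_class_P_at[OF assms(1-3), of \<eta>] assms(6) by auto
  then show ?thesis
    using main assms(5) by (intro that[of "z0 ^ Suc 2 * g z0"]) auto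
qed

section \<open>The boundary curve\<close>

lemma continuous_boundary_curve:
  assumes "norm lam < 1" "z0 \<in> ball 0 1"
  shows "continuous_on UNIV (boundary_curve \<gamma> \<beta> lam z0)"
proof -
  have *: "norm (of_real t * z0) < 1" if "t \<in> {0..1}" for t
    using assms that by (auto simp: norm_mult intro: le_less_trans[OF mult_left_le_one_le])
  have eq: "boundary_curve \<gamma> \<beta> lam z0 \<theta> = integral {0..1} (\<lambda>t.
      (1 + coef \<gamma> \<beta> * ((cis \<theta> * (of_real t * z0) + lam) * (of_real t * z0) / H_den lam (of_real t * z0) (cis \<theta> * (of_real t * z0)))) * z0)" for \<theta>
    unfolding boundary_curve_def contour_integral_integral
    by (intro integral_cong) (use * in \<open>simp add: linepath_def H_fun_eq assms scaleR_conv_of_real\<close>)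
  have "H_den lam (of_real t * z0) (cis \<theta> * (of_real t * z0)) \<noteq> 0" if "t \<in> {0..1}" for t \<theta>
    using *[OF that] assms by (intro H_den_nonzero) (auto simp: norm_mult)
  then show ?thesis
    unfolding eq unfolding H_den_def box_real(2)[symmetric]
    by (intro integral_continuous_on_param) (auto intro!: continuous_intros simp: split_beta)
qed

lemma H_fun_inject:
  assumes "\<beta> < 1" "\<bar>\<gamma>\<bar> < pi / 2" "norm lam < 1" "norm a \<le> 1" "norm b \<le> 1"
    and eq: "\<And>z. z \<in> ball 0 1 \<Longrightarrow> H_fun \<gamma> \<beta> a lam z = H_fun \<gamma> \<beta> b lam z"
  shows "a = b"
proof -
  \<comment> \<open>Every nonzero point of the disc could replace \<open>1/2\<close>.\<close>
  have h: "norm (1/2 :: complex) < 1"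
    by simp
  have "norm (a * (1/2)) \<le> 1" "norm (b * (1/2)) \<le> 1"
    using assms by (auto simp: norm_mult norm_divide)
  then have "H_den lam (1/2) (a * (1/2)) \<noteq> 0" "H_den lam (1/2) (b * (1/2)) \<noteq> 0"
    using H_den_nonzero[OF assms(3) h] by blast+
  moreover have "1 - lam * cnj lam \<noteq> 0"
    using norm_cnj_minus_less[of lam "cnj lam"] assms by auto
  ultimately show ?thesis
    using H_fun_diff[OF assms(3) h assms(4,5), of \<gamma> \<beta>] eq[of "1/2"] coef_nonzero[OF assms(1,2)] by simp
qed

lemma cis_minus_pi: "cis (- pi) = cis pi"
  by (simp add: complex_eq_iff)

lemma cis_inject_closed_interval:
  assumes "cis s = cis t" "s \<in> {-pi..pi}" "t \<in> {-pi..pi}"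
  shows "s = t \<or> s = - pi \<and> t = pi \<or> s = pi \<and> t = - pi"
proof -
  have "sin s = sin t \<and> cos s = cos t"
    using assms(1) by (auto simp: complex_eq_iff)
  then obtain n :: int where n: "s = t + 2 * pi * n"
    using sin_cos_eq_iff by blast
  have "\<bar>2 * pi * n\<bar> \<le> 2 * pi"
    using n assms(2,3) by auto
  then have "2 * pi * \<bar>real_of_int n\<bar> \<le> 2 * pi * 1"
    by (simp add: abs_mult)
  then have "\<bar>real_of_int n\<bar> \<le> 1"
    by (subst (asm) mult_le_cancel_left_pos) auto
  then have "\<bar>n\<bar> \<le> 1"
    by linarith
  then consider "n = 0" | "n = 1" | "n = -1"
    by linarith
  then show ?thesis
    using n assms(2,3) by cases auto
qed

text \<open>
  The point belongs to \<open>V_P\<close>, and moving from it in the supporting direction leaves \<open>V_P\<close> at once.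
\<close>
lemma boundary_curve_in_frontier:
  assumes "\<beta> < 1" "\<bar>\<gamma>\<bar> < pi / 2" "norm lam < 1" "z0 \<in> ball 0 1" "z0 \<noteq> 0"
  shows "boundary_curve \<gamma> \<beta> lam z0 \<theta> \<in> frontier (V_P \<gamma> \<beta> z0 lam)"
proof -
  let ?V = "V_P \<gamma> \<beta> z0 lam" and ?B = "boundary_curve \<gamma> \<beta> lam z0 \<theta>"
  obtain D where D: "D \<noteq> 0" and supp: "\<And>P. P \<in> class_P_at \<gamma> \<beta> lam \<Longrightarrow>
       Re ((?B - contour_integral (linepath 0 z0) P) / D) \<ge> 0"
    unfolding boundary_curve_def by (rule supporting_direction[OF assms norm_cis]) blast
  have "?B \<in> ?V"
    unfolding V_P_def boundary_curve_def using H_fun_in_class_P_at[OF assms(1-3), of "cis \<theta>"] by auto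
  moreover have "?B \<notin> interior ?V"
  proof
    assume "?B \<in> interior ?V"
    then obtain e where e: "e > 0" "ball ?B e \<subseteq> ?V"
      by (auto simp: mem_interior)
    define t where "t = e / (2 * norm D)"
    have t: "t > 0"
      using e D by (simp add: t_def)
    have "norm (of_real t * D) < e"
      using e D by (simp add: t_def norm_mult norm_divide)
    then have "?B + of_real t * D \<in> ?V"
      using e by (intro subsetD[OF e(2)]) (simp add: dist_norm)
    then obtain P where "P \<in> class_P_at \<gamma> \<beta> lam" "?B + of_real t * D = contour_integral (linepath 0 z0) P"
      unfolding V_P_def by auto
    then have "Re ((?B - (?B + of_real t * D)) / D) \<ge> 0"
      using supp by metis
    then show False
      using D t by simp
  qed
  ultimately show ?thesis
    using closure_subset by (auto simp: frontier_def)
qed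

text \<open>
  If the curve takes the same value at two angles, the uniqueness part of the support
  property identifies the two extremal functions, and these determine the angle modulo \<open>2 \<pi>\<close>.
\<close>
lemma jordan_curve_boundary_curve:
  assumes "\<beta> < 1" "\<bar>\<gamma>\<bar> < pi / 2" "norm lam < 1" "z0 \<in> ball 0 1" "z0 \<noteq> 0"
  shows "jordan_curve_angle (boundary_curve \<gamma> \<beta> lam z0)"
proof -
  let ?g = "\<lambda>t. boundary_curve \<gamma> \<beta> lam z0 ((2 * t - 1) * pi)"
  have inj: "cis s = cis t" if "boundary_curve \<gamma> \<beta> lam z0 s = boundary_curve \<gamma> \<beta> lam z0 t" for s t
  proof -
    obtain D where uniq: "\<And>P z. P \<in> class_P_at \<gamma> \<beta> lam \<Longrightarrow>
       Re ((boundary_curve \<gamma> \<beta> lam z0 s - contour_integral (linepath 0 z0) P) / D) = 0 \<Longrightarrow>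
       z \<in> ball 0 1 \<Longrightarrow> P z = H_fun \<gamma> \<beta> (cis s) lam z"
      unfolding boundary_curve_def by (rule supporting_direction[OF assms norm_cis]) blast
    have "H_fun \<gamma> \<beta> (cis t) lam z = H_fun \<gamma> \<beta> (cis s) lam z" if "z \<in> ball 0 1" for z
      using uniq[OF H_fun_in_class_P_at[OF assms(1-3), of "cis t"] _ that] \<open>boundary_curve \<gamma> \<beta> lam z0 s = boundary_curve \<gamma> \<beta> lam z0 t\<close>
      by (simp add: boundary_curve_def)
    then show ?thesis
      using H_fun_inject[OF assms(1-3), of "cis s" "cis t"] by simp
  qed
  have "path ?g"
    unfolding path_def
    by (intro continuous_on_compose2[OF continuous_boundary_curve[OF assms(3,4)]] continuous_intros) auto
  moreover have "loop_free ?g"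
    unfolding loop_free_def
  proof (intro ballI impI)
    fix x y :: real
    assume x: "x \<in> {0..1}" and y: "y \<in> {0..1}" and "?g x = ?g y"
    then have c: "cis ((2 * x - 1) * pi) = cis ((2 * y - 1) * pi)"
      using inj by blast
    have r: "(2 * x - 1) * pi \<in> {-pi..pi}" if "x \<in> {0..1}" for x
      using that by (auto simp: algebra_simps)
    show "x = y \<or> x = 0 \<and> y = 1 \<or> x = 1 \<and> y = 0"
      using cis_inject_closed_interval[OF c r[OF x] r[OF y]] by (auto simp: algebra_simps)
  qed
  moreover have "pathfinish ?g = pathstart ?g"
    by (simp add: pathfinish_def pathstart_def boundary_curve_def cis_minus_pi)
  ultimately show ?thesis
    by (simp add: jordan_curve_angle_def simple_path_def)
qed

theorem theorem5p1:
  fixes \<beta> \<gamma> :: real and lam z0 :: complex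
  assumes "\<beta> < 1" and "\<bar>\<gamma>\<bar> < pi / 2"
    and "lam \<in> ball 0 1" and "z0 \<in> ball 0 1 - {0}"
  shows "jordan_curve_angle (boundary_curve \<gamma> \<beta> lam z0)
    \<and> frontier (V_P \<gamma> \<beta> z0 lam) = boundary_curve \<gamma> \<beta> lam z0 ` {- pi<..pi}
    \<and> (\<forall>\<theta>\<in>{- pi<..pi}. boundary_curve \<gamma> \<beta> lam z0 \<theta> =
         contour_integral (linepath 0 z0) (\<lambda>\<zeta>.
           (1 + (2 * (1 - of_real \<beta>) * of_real (cos \<gamma>) * cis (- \<gamma>) - 1) * delta (cis \<theta> * \<zeta>) lam * \<zeta>)
           / (1 - delta (cis \<theta> * \<zeta>) lam * \<zeta>)))
    \<and> (\<forall>P\<in>class_P_at \<gamma> \<beta> lam. \<forall>\<theta>\<in>{- pi<..pi}.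
         contour_integral (linepath 0 z0) P
           = contour_integral (linepath 0 z0) (H_fun \<gamma> \<beta> (cis \<theta>) lam)
         \<longrightarrow> (\<forall>z\<in>ball 0 1. P z = H_fun \<gamma> \<beta> (cis \<theta>) lam z))"
proof (intro conjI ballI impI)
  let ?b = "boundary_curve \<gamma> \<beta> lam z0" and ?g = "\<lambda>t. boundary_curve \<gamma> \<beta> lam z0 ((2 * t - 1) * pi)"
  have hyps: "\<beta> < 1" "\<bar>\<gamma>\<bar> < pi / 2" "norm lam < 1" "z0 \<in> ball 0 1" "z0 \<noteq> 0"
    using assms by auto
  show J: "jordan_curve_angle ?b"
    using jordan_curve_boundary_curve[OF hyps] .
  have "path_image ?g = ?b ` ((\<lambda>t. (2 * t - 1) * pi) ` {0..1})"
    by (simp add: path_image_def image_image)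
  also have "(\<lambda>t. (2 * t - 1) * pi) ` {0..1} = {-pi..pi}"
  proof
    show "(\<lambda>t. (2 * t - 1) * pi) ` {0..1} \<subseteq> {-pi..pi}"
      by (auto simp: algebra_simps)
    show "{-pi..pi} \<subseteq> (\<lambda>t. (2 * t - 1) * pi) ` {0..1}"
    proof
      fix s assume "s \<in> {-pi..pi}"
      then show "s \<in> (\<lambda>t. (2 * t - 1) * pi) ` {0..1}"
        by (intro image_eqI[of _ _ "(s / pi + 1) / 2"]) (auto simp: field_simps)
    qed
  qed
  also have "?b ` {-pi..pi} = ?b ` {-pi<..pi}"
  proof -
    have "?b (- pi) = ?b pi"
      by (simp add: boundary_curve_def cis_minus_pi)
    moreover have "{-pi..pi} = insert (-pi) {-pi<..pi}"
      by auto
    ultimately show ?thesis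
      by (auto simp: image_iff intro!: bexI[of _ pi])
  qed
  finally have img: "path_image ?g = ?b ` {-pi<..pi}" .
  have "path_image ?g \<subseteq> frontier (V_P \<gamma> \<beta> z0 lam)"
    unfolding img using boundary_curve_in_frontier[OF hyps] by auto
  then show "frontier (V_P \<gamma> \<beta> z0 lam) = ?b ` {-pi<..pi}"
    using frontier_convex_eq_Jordan_curve[OF convex_V_P[OF hyps(4)], of ?g] J img
    unfolding jordan_curve_angle_def Let_def by metis
  show "?b \<theta> = contour_integral (linepath 0 z0) (\<lambda>\<zeta>.
           (1 + (2 * (1 - of_real \<beta>) * of_real (cos \<gamma>) * cis (- \<gamma>) - 1) * delta (cis \<theta> * \<zeta>) lam * \<zeta>)
           / (1 - delta (cis \<theta> * \<zeta>) lam * \<zeta>))" for \<theta>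
    unfolding boundary_curve_def
  proof (rule contour_integral_cong[OF refl])
    fix z assume "z \<in> path_image (linepath 0 z0)"
    moreover have "closed_segment 0 z0 \<subseteq> ball 0 1"
      using hyps by (intro closed_segment_subset) auto
    ultimately have z: "norm z < 1"
      by auto
    define x where "x = delta (cis \<theta> * z) lam * z"
    have "norm x \<le> norm (delta (cis \<theta> * z) lam)"
      using z by (simp add: x_def norm_mult mult_left_le)
    also have "\<dots> < 1"
      using z hyps by (intro norm_delta_less_1) (auto simp: norm_mult)
    finally have "1 - x \<noteq> 0"
      by auto
    then have "1 + coef \<gamma> \<beta> * (x / (1 - x)) = (1 + (coef \<gamma> \<beta> - 1) * x) / (1 - x)"
      by (simp add: field_simps)
    moreover have coef: "2 * (1 - of_real \<beta>) * of_real (cos \<gamma>) * cis (- \<gamma>) = coef \<gamma> \<beta>"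
      by (simp add: coef_def)
    ultimately show "H_fun \<gamma> \<beta> (cis \<theta>) lam z =
       (1 + (2 * (1 - of_real \<beta>) * of_real (cos \<gamma>) * cis (- \<gamma>) - 1) * delta (cis \<theta> * z) lam * z)
           / (1 - delta (cis \<theta> * z) lam * z)"
      unfolding H_fun_coef coef x_def by (simp only: mult.assoc)
  qed
  show "P z = H_fun \<gamma> \<beta> (cis \<theta>) lam z"
    if P: "P \<in> class_P_at \<gamma> \<beta> lam" and z: "z \<in> ball 0 1"
      and eq: "contour_integral (linepath 0 z0) P = contour_integral (linepath 0 z0) (H_fun \<gamma> \<beta> (cis \<theta>) lam)"
    for P \<theta> z
  proof -
    obtain D where "\<And>P z. P \<in> class_P_at \<gamma> \<beta> lam \<Longrightarrow>
       Re ((contour_integral (linepath 0 z0) (H_fun \<gamma> \<beta> (cis \<theta>) lam) - contour_integral (linepath 0 z0) P) / D) = 0 \<Longrightarrow>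
       z \<in> ball 0 1 \<Longrightarrow> P z = H_fun \<gamma> \<beta> (cis \<theta>) lam z"
      by (rule supporting_direction[OF hyps norm_cis]) blast
    from this[OF P _ z] show ?thesis
      using eq by simp
  qed
qed

end
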